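(* Let $\langle X,(A_i)_{i\in X},p,r,\gamma\rangle$ be a finite Markov Decision Process with $n$ states, a total of $m$ actions, and discount factor $\gamma\in(0,1)$. Then Howard's Policy Iteration (started from any policy) terminates after at most $$(m-n)\left\lceil \frac{1}{1-\gamma}\log\left(\frac{1}{1-\gamma}\right)\right\rceil = O\left(\frac{m}{1-\gamma}\log\frac{1}{1-\gamma}\right)$$ iterations.
   Context: A finite Markov Decision Process (MDP) consists of a state space $X=\{1,\dots,n\}$; a finite action space $A$ of size $m$, partitioned into nonempty sets $A_i$ ($i\in X$), where $A_i$ is the set of admissible actions in state $i$; transition probabilities $p_{ij}(a)=\mathbb{P}(i_{t+1}=j\mid i_t=i,a_t=a)$ for $a\in A_i$; a reward function $r(i,a,j)\in\mathbb{R}$; and a discount factor $\gamma\in(0,1)$. A policy is a map $\pi:X\to A$ with $\pi(i)\in A_i$ for all $i$. Let $P_\pi$ be the $n\times n$ stochastic matrix with entries $p_{ij}(\pi(i))$ and $r_\pi$ the vector with components $\sum_j p_{ij}(\pi(i))r(i,\pi(i),j)$. The operator $T_\pi$ is $T_\pi v=r_\pi+\gamma P_\pi v$, and the value $v_\pi\in\mathbb{R}^n$ of $\pi$ is its unique fixed point (the expected $\gamma$-discounted sum of rewards). The optimal value is $v_*=\max_\pi v_\pi$ (componentwise); a policy is optimal if its value is $v_*$. Let $Tv=\max_\pi T_\pi v$ (componentwise); a policy $\pi$ is greedy with respect to $v$ if $T_\pi v=Tv$, and $\mathcal{G}(v)$ denotes any such policy. The maximal advantage with respect to $\pi$ is $a_\pi=Tv_\pi-v_\pi\ge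 0$, and $S_\pi=\{i: a_\pi(i)>0\}$ is the set of switchable states; $\pi$ is optimal iff $S_\pi=\emptyset$. For nonempty $Y\subseteq S_\pi$, $\mathrm{switch}(\pi,Y)$ is the policy equal to $\mathcal{G}(v_\pi)(i)$ for $i\in Y$ and to $\pi(i)$ for $i\notin Y$. Howard's Policy Iteration generates, from an initial policy $\pi_0$, the sequence $\pi_{k+1}=\mathrm{switch}(\pi_k,S_{\pi_k})$ (it switches actions in all states with positive maximal advantage). It terminates when $\pi_k$ is optimal; one iteration is one update $\pi_k\to\pi_{k+1}$. $\log$ is the natural logarithm. *)

theory Defs
  imports "HOL-Analysis.Analysis" "HOL-Library.Landau_Symbols"
begin

text \<open>
  States and actions are the elements of two finite types, so that \<open>n = CARD('x)\<close> and
  \<open>m = CARD('a)\<close>, and \<open>Adm\<close> partitions the whole action type. Here \<open>p i j a\<close> is the probability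
  of moving from \<open>i\<close> to \<open>j\<close> under \<open>a\<close>; its value is irrelevant (and unconstrained) when \<open>a\<close>
  is not admissible in \<open>i\<close>.
\<close>

locale finite_mdp =
  fixes Adm :: "'x::finite \<Rightarrow> 'a::finite set"
    and p :: "'x \<Rightarrow> 'x \<Rightarrow> 'a \<Rightarrow> real"
    and r :: "'x \<Rightarrow> 'a \<Rightarrow> 'x \<Rightarrow> real"
    and \<gamma> :: real
  assumes Adm_nonempty: "\<And>i. Adm i \<noteq> {}"
    and Adm_disjoint: "disjoint_family Adm"
    and Adm_cover: "(\<Union>i. Adm i) = UNIV"
    and p_nonneg: "\<And>i j a. a \<in> Adm i \<Longrightarrow> 0 \<le> p i j a"
    and p_sum: "\<And>i a. a \<in> Adm i \<Longrightarrow> (\<Sum>j\<in>UNIV. p i j a) = 1"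
    and discount_pos: "0 < \<gamma>"
    and discount_less_1: "\<gamma> < 1"
begin

definition policies :: "('x \<Rightarrow> 'a) set" where
  "policies = {\<pi>. \<forall>i. \<pi> i \<in> Adm i}"

definition P_pol :: "('x \<Rightarrow> 'a) \<Rightarrow> real ^ 'x ^ 'x" where
  "P_pol \<pi> = (\<chi> i j. p i j (\<pi> i))"

definition r_pol :: "('x \<Rightarrow> 'a) \<Rightarrow> real ^ 'x" where
  "r_pol \<pi> = (\<chi> i. \<Sum>j\<in>UNIV. p i j (\<pi> i) * r i (\<pi> i) j)"

definition T_pol :: "('x \<Rightarrow> 'a) \<Rightarrow> real ^ 'x \<Rightarrow> real ^ 'x" where
  "T_pol \<pi> v = r_pol \<pi> + \<gamma> *\<^sub>R (P_pol \<pi> *v v)"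

definition val :: "('x \<Rightarrow> 'a) \<Rightarrow> real ^ 'x" where
  "val \<pi> = (THE v. T_pol \<pi> v = v)"

definition opt_val :: "real ^ 'x" where
  "opt_val = (\<chi> i. Max ((\<lambda>\<pi>. val \<pi> $ i) ` policies))"

definition optimal :: "('x \<Rightarrow> 'a) \<Rightarrow> bool" where
  "optimal \<pi> \<longleftrightarrow> \<pi> \<in> policies \<and> val \<pi> = opt_val"

definition T_opt :: "real ^ 'x \<Rightarrow> real ^ 'x" where
  "T_opt v = (\<chi> i. Max ((\<lambda>\<pi>. T_pol \<pi> v $ i) ` policies))"

definition greedy :: "real ^ 'x \<Rightarrow> ('x \<Rightarrow> 'a) \<Rightarrow> bool" where
  "greedy v \<pi> \<longleftrightarrow> \<pi> \<in> policies \<and> T_pol \<pi> v = T_opt v"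

definition max_advantage :: "('x \<Rightarrow> 'a) \<Rightarrow> real ^ 'x" where
  "max_advantage \<pi> = T_opt (val \<pi>) - val \<pi>"

definition switchable :: "('x \<Rightarrow> 'a) \<Rightarrow> 'x set" where
  "switchable \<pi> = {i. max_advantage \<pi> $ i > 0}"

text \<open>
  Greedy policies need not be unique, so switching is a relation: \<open>is_switch \<pi> Y \<pi>'\<close> holds for
  every \<open>\<pi>'\<close> obtained from some choice of a greedy policy with respect to \<open>val \<pi>\<close>.
\<close>

definition is_switch :: "('x \<Rightarrow> 'a) \<Rightarrow> 'x set \<Rightarrow> ('x \<Rightarrow> 'a) \<Rightarrow> bool" where
  "is_switch \<pi> Y \<pi>' \<longleftrightarrow>
     (\<exists>g. greedy (val \<pi>) g \<and> \<pi>' = (\<lambda>i. if i \<in> Y then g i else \<pi> i))"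

text \<open>
  The greedy policy may be chosen afresh in every iteration. The run stops at the first optimal
  policy; the entries of the sequence after that point are unconstrained.
\<close>

definition howard_run :: "(nat \<Rightarrow> 'x \<Rightarrow> 'a) \<Rightarrow> bool" where
  "howard_run \<pi> \<longleftrightarrow> \<pi> 0 \<in> policies \<and>
     (\<forall>k. (\<forall>l\<le>k. \<not> optimal (\<pi> l)) \<longrightarrow> is_switch (\<pi> k) (switchable (\<pi> k)) (\<pi> (Suc k)))"

end

end

theory Submission
  imports Defs
begin

text \<open>
  Along a run, \<open>v\<^sub>* - v\<^bsub>\<pi> k\<^esub>\<close> contracts by the factor \<open>\<gamma>\<close> in the sup norm. For every policy,
  \<open>v\<^sub>* - T\<^sub>\<pi> v\<^sub>* \<le> v\<^sub>* - v\<^sub>\<pi>\<close> pointwise and \<open>\<parallel>v\<^sub>* - v\<^sub>\<pi>\<parallel> \<le> \<parallel>v\<^sub>* - T\<^sub>\<pi> v\<^sub>*\<parallel> / (1 - \<gamma>)\<close>. Let \<open>s\<close> be a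
  state in which \<open>v\<^sub>* - T\<^sub>\<pi> v\<^sub>*\<close> is maximal for the current, non-optimal policy \<open>\<pi>\<close>. Once
  \<open>\<gamma>^K < 1 - \<gamma>\<close>, no policy at least \<open>K\<close> iterations later can use the action \<open>\<pi> s\<close> in \<open>s\<close>. So every
  \<open>K\<close> iterations eliminate for good an action that is not greedy for \<open>v\<^sub>*\<close>, and there are at most
  \<open>m - n\<close> such actions, because each state has at least one greedy action.
\<close>

lemma finite_arg_max:
  fixes f :: "'b \<Rightarrow> 'c::linorder"
  assumes "finite A" "A \<noteq> {}"
  obtains x where "x \<in> A" "\<And>y. y \<in> A \<Longrightarrow> f y \<le> f x"
proof -
  have "Max (f ` A) \<in> f ` A" using assms by simp
  then obtain x where "x \<in> A" "Max (f ` A) = f x" by blast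
  then show thesis using that[of x] assms(1) by (metis Max_ge finite_imageI imageI)
qed

section \<open>Action values and policy evaluation\<close>

context finite_mdp
begin

text \<open>The Q-value of an action relative to \<open>v\<close>. It makes explicit that component
  \<open>i\<close> of \<open>T_pol \<pi> v\<close> depends on \<open>\<pi>\<close> only through
  \<open>\<pi> i\<close>.\<close>

definition action_val :: "real ^ 'x \<Rightarrow> 'x \<Rightarrow> 'a \<Rightarrow> real" where
  "action_val v i a = (\<Sum>j\<in>UNIV. p i j a * (r i a j + \<gamma> * v $ j))"

lemma T_pol_nth: "T_pol \<pi> v $ i = action_val v i (\<pi> i)"
  by (simp add: T_pol_def r_pol_def P_pol_def matrix_vector_mult_def action_val_def
      algebra_simps sum.distrib sum_distrib_left)

lemma action_val_diff:
  "action_val v i a - action_val w i a = \<gamma> * (\<Sum>j\<in>UNIV. p i j a * (v $ j - w $ j))"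
  by (simp add: action_val_def algebra_simps sum_distrib_left flip: sum_subtractf)

text \<open>The difference is \<open>\<gamma>\<close> times a weighted average. Since the bound is
  one-sided, it provides both the contraction estimate and, with \<open>c = 0\<close>,
  monotonicity.\<close>

lemma action_val_diff_le:
  assumes "a \<in> Adm i" "\<And>j. v $ j - w $ j \<le> c"
  shows "action_val v i a - action_val w i a \<le> \<gamma> * c"
proof -
  have "(\<Sum>j\<in>UNIV. p i j a * (v $ j - w $ j)) \<le> (\<Sum>j\<in>UNIV. p i j a * c)"
    by (intro sum_mono mult_left_mono assms p_nonneg)
  also have "\<dots> = c"
    using p_sum[OF assms(1)] by (simp flip: sum_distrib_right)
  finally show ?thesis
    using discount_pos by (simp add: action_val_diff)
qed

lemma action_val_mono:
  assumes "a \<in> Adm i" "\<And>j. v $ j \<le> w $ j"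
  shows "action_val v i a \<le> action_val w i a"
  using action_val_diff_le[of a i v w 0] assms by simp

lemma policies_nonempty: "policies \<noteq> {}"
proof -
  have "(\<lambda>i. SOME a. a \<in> Adm i) \<in> policies"
    using Adm_nonempty by (auto simp: policies_def some_in_eq)
  then show ?thesis by blast
qed

lemma policiesD: "\<pi> \<in> policies \<Longrightarrow> \<pi> i \<in> Adm i"
  by (simp add: policies_def)

text \<open>Evaluate the difference where it is largest: it is at most \<open>\<gamma>\<close> times itself plus \<open>(1 - \<gamma>) * c\<close>.\<close>
lemma T_pol_comparison:
  assumes \<pi>: "\<pi> \<in> policies"
    and le: "\<And>i. T_pol \<pi> w $ i - w $ i \<le> T_pol \<pi> v $ i - v $ i + (1 - \<gamma>) * c"
  shows "v $ i - w $ i \<le> c"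
proof -
  obtain s where s: "\<And>j. v $ j - w $ j \<le> v $ s - w $ s"
    using finite_arg_max[of UNIV "\<lambda>j. v $ j - w $ j"] by auto
  have "T_pol \<pi> v $ s - T_pol \<pi> w $ s \<le> \<gamma> * (v $ s - w $ s)"
    unfolding T_pol_nth by (rule action_val_diff_le) (use \<pi> s in \<open>auto simp: policiesD\<close>)
  with le[of s] have "(1 - \<gamma>) * (v $ s - w $ s) \<le> (1 - \<gamma>) * c"
    by (simp add: algebra_simps)
  then have "v $ s - w $ s \<le> c"
    using discount_less_1 by simp
  with s[of i] show ?thesis by simp
qed

text \<open>Comparison with \<open>c = 0\<close> in both directions. Allowing arbitrary equal
  residuals covers uniqueness of the fixed point and also the injectivity needed for its
  existence.\<close>

lemma T_pol_residual_inj: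
  assumes "\<pi> \<in> policies" "T_pol \<pi> v - v = T_pol \<pi> w - w"
  shows "v = w"
proof -
  have "T_pol \<pi> v $ i - v $ i = T_pol \<pi> w $ i - w $ i" for i
    using assms(2) by (metis vector_minus_component)
  then have "v $ i = w $ i" for i
    using T_pol_comparison[of \<pi> v w 0 i] T_pol_comparison[of \<pi> w v 0 i] assms(1) by simp
  then show ?thesis by (simp add: vec_eq_iff)
qed

lemma T_pol_fixed_point_exists:
  assumes "\<pi> \<in> policies"
  shows "\<exists>v. T_pol \<pi> v = v"
proof -
  \<comment> \<open>Fixed points are the solutions of \<open>L v = r_pol \<pi>\<close>, and an
    injective linear endomorphism of a finite-dimensional space is surjective.\<close>
  define L where "L = (\<lambda>v. v - \<gamma> *\<^sub>R (P_pol \<pi> *v v))"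
  have residual: "T_pol \<pi> v - v = r_pol \<pi> - L v" for v
    by (simp add: L_def T_pol_def)
  have "linear L"
    unfolding L_def
    by (rule linearI) (simp_all add: algebra_simps)
  moreover have "inj L"
    by (rule injI, rule T_pol_residual_inj[OF assms]) (simp only: residual)
  ultimately have "surj L"
    using linear_injective_imp_surjective by blast
  then obtain v where "r_pol \<pi> = L v" by (rule surjE)
  then have "T_pol \<pi> v = v" using residual[of v] by simp
  then show ?thesis ..
qed

lemma T_pol_val:
  assumes "\<pi> \<in> policies"
  shows "T_pol \<pi> (val \<pi>) = val \<pi>"
proof -
  have "\<exists>!v. T_pol \<pi> v = v"
    using T_pol_fixed_point_exists T_pol_residual_inj assms by (metis diff_self)
  then show ?thesis unfolding val_def by (rule theI')
qed

lemma val_unique: "\<pi> \<in> policies \<Longrightarrow> T_pol \<pi> v = v \<Longrightarrow> val \<pi> = v"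
  using T_pol_residual_inj T_pol_val by (metis diff_self)

lemma val_ge:
  assumes "\<pi> \<in> policies" "\<And>i. v $ i \<le> T_pol \<pi> v $ i"
  shows "v $ i \<le> val \<pi> $ i"
  using T_pol_comparison[of \<pi> "val \<pi>" v 0 i] assms by (simp add: T_pol_val)

lemma val_le:
  assumes "\<pi> \<in> policies" "\<And>i. T_pol \<pi> v $ i \<le> v $ i"
  shows "val \<pi> $ i \<le> v $ i"
  using T_pol_comparison[of \<pi> v "val \<pi>" 0 i] assms by (simp add: T_pol_val)

section \<open>Bellman optimality and the distance to the optimum\<close>

lemma T_opt_ge: "\<pi> \<in> policies \<Longrightarrow> T_pol \<pi> v $ i \<le> T_opt v $ i"
  by (simp add: T_opt_def)

lemma ex_greedy: "\<exists>\<pi>. greedy v \<pi>"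
proof -
  have "T_opt v $ i \<in> (\<lambda>\<pi>. T_pol \<pi> v $ i) ` policies" for i
    using policies_nonempty by (simp add: T_opt_def Max_in)
  then obtain f where f: "\<And>i. f i \<in> policies" "\<And>i. T_opt v $ i = T_pol (f i) v $ i"
    unfolding image_iff by metis
  \<comment> \<open>The maximiser \<open>f i\<close> may vary with \<open>i\<close>, but only its
    action in \<open>i\<close> matters there, so the diagonal policy attains all maxima at
    once.\<close>
  have "greedy v (\<lambda>i. f i i)"
    using f by (auto simp: greedy_def policies_def vec_eq_iff T_pol_nth)
  then show ?thesis by blast
qed

lemma T_opt_val_ge: "\<pi> \<in> policies \<Longrightarrow> val \<pi> $ i \<le> T_opt (val \<pi>) $ i"
  using T_opt_ge[of \<pi> "val \<pi>" i] by (simp add: T_pol_val)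

text \<open>A policy maximising the sum of the values cannot be improved by a greedy step.\<close>
lemma ex_T_opt_fixed_val: "\<exists>\<pi>\<in>policies. T_opt (val \<pi>) = val \<pi>"
proof -
  obtain \<pi> where \<pi>: "\<pi> \<in> policies"
    and max: "\<And>\<rho>. \<rho> \<in> policies \<Longrightarrow> (\<Sum>i\<in>UNIV. val \<rho> $ i) \<le> (\<Sum>i\<in>UNIV. val \<pi> $ i)"
    using finite_arg_max[of policies "\<lambda>\<pi>. \<Sum>i\<in>UNIV. val \<pi> $ i"] policies_nonempty by auto
  obtain g where g: "g \<in> policies" "T_pol g (val \<pi>) = T_opt (val \<pi>)"
    using ex_greedy by (auto simp: greedy_def)
  have ge: "val \<pi> $ i \<le> val g $ i" for i
    using val_ge[OF g(1), of "val \<pi>"] g(2) T_opt_val_ge[OF \<pi>] by simp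
  have "val \<pi> $ i = val g $ i" for i
    using sum_strict_mono_ex1[of UNIV "\<lambda>i. val \<pi> $ i" "\<lambda>i. val g $ i"] ge max[OF g(1)]
    by (meson UNIV_I finite_code linorder_not_le order_le_less)
  then have "val \<pi> = val g" by (simp add: vec_eq_iff)
  then show ?thesis using \<pi> g T_pol_val by metis
qed

text \<open>A fixed point \<open>v\<close> of \<open>T_opt\<close> satisfies
  \<open>T_pol \<rho> v \<le> v\<close> for every policy \<open>\<rho>\<close>, hence dominates
  every \<open>val \<rho>\<close>.\<close>

lemma opt_val_eqI:
  assumes "\<pi> \<in> policies" "T_opt (val \<pi>) = val \<pi>"
  shows "opt_val = val \<pi>"
proof -
  have "val \<rho> $ i \<le> val \<pi> $ i" if "\<rho> \<in> policies" for \<rho> i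
    using val_le[OF that, of "val \<pi>"] T_opt_ge[OF that, of "val \<pi>"] assms(2) by simp
  then show ?thesis
    using assms(1) by (auto simp: opt_val_def vec_eq_iff intro!: Max_eqI)
qed

lemma ex_optimal: "\<exists>\<pi>. optimal \<pi>"
  using ex_T_opt_fixed_val opt_val_eqI by (metis optimal_def)

lemma T_opt_opt_val: "T_opt opt_val = opt_val"
  using ex_T_opt_fixed_val opt_val_eqI by metis

lemma T_pol_opt_val_le: "\<pi> \<in> policies \<Longrightarrow> T_pol \<pi> opt_val $ i \<le> opt_val $ i"
  using T_opt_ge[of \<pi> opt_val i] by (simp add: T_opt_opt_val)

lemma opt_val_ge: "\<pi> \<in> policies \<Longrightarrow> val \<pi> $ i \<le> opt_val $ i"
  by (rule val_le) (auto simp: T_pol_opt_val_le)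

text \<open>Apply the monotone operator \<open>T_pol \<pi>\<close> to
  \<open>val \<pi> \<le> opt_val\<close>.\<close>

lemma residual_le_loss:
  assumes "\<pi> \<in> policies"
  shows "opt_val $ i - T_pol \<pi> opt_val $ i \<le> opt_val $ i - val \<pi> $ i"
proof -
  have "T_pol \<pi> (val \<pi>) $ i \<le> T_pol \<pi> opt_val $ i"
    unfolding T_pol_nth by (intro action_val_mono policiesD opt_val_ge assms)
  then show ?thesis by (simp add: T_pol_val assms)
qed

text \<open>In the comparison, \<open>val \<pi>\<close> contributes residual zero and
  \<open>opt_val\<close> at least \<open>- M\<close>.\<close>

lemma loss_le_residual:
  assumes "\<pi> \<in> policies" "\<And>i. opt_val $ i - T_pol \<pi> opt_val $ i \<le> M"
  shows "opt_val $ i - val \<pi> $ i \<le> M / (1 - \<gamma>)"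
proof (rule T_pol_comparison[OF assms(1)])
  fix j
  show "T_pol \<pi> (val \<pi>) $ j - val \<pi> $ j
      \<le> T_pol \<pi> opt_val $ j - opt_val $ j + (1 - \<gamma>) * (M / (1 - \<gamma>))"
    using assms(2)[of j] discount_less_1 by (simp add: T_pol_val assms(1))
qed

lemma optimalI_residual:
  assumes "\<pi> \<in> policies" "\<And>i. opt_val $ i \<le> T_pol \<pi> opt_val $ i"
  shows "optimal \<pi>"
proof -
  have "T_pol \<pi> opt_val = opt_val"
    using assms T_pol_opt_val_le by (simp add: vec_eq_iff order_antisym)
  then show ?thesis using assms(1) val_unique by (simp add: optimal_def)
qed

section \<open>Howard's update and contraction along a run\<close>

lemma is_switch_policies:
  "\<pi> \<in> policies \<Longrightarrow> is_switch \<pi> Y \<pi>' \<Longrightarrow> \<pi>' \<in> policies"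
  by (auto simp: is_switch_def greedy_def policies_def)

text \<open>Outside the switchable set \<open>\<pi>\<close> is itself greedy, so Howard's update is greedy everywhere.\<close>
lemma howard_switch_greedy:
  assumes \<pi>: "\<pi> \<in> policies" and sw: "is_switch \<pi> (switchable \<pi>) \<pi>'"
  shows "T_pol \<pi>' (val \<pi>) = T_opt (val \<pi>)"
proof -
  obtain g where g: "T_pol g (val \<pi>) = T_opt (val \<pi>)"
    and \<pi>': "\<pi>' = (\<lambda>i. if i \<in> switchable \<pi> then g i else \<pi> i)"
    using sw by (auto simp: is_switch_def greedy_def)
  have "T_pol \<pi>' (val \<pi>) $ i = T_opt (val \<pi>) $ i" for i
  proof (cases "i \<in> switchable \<pi>")
    case True
    then show ?thesis using g by (metis T_pol_nth \<pi>')
  next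
    case False
    then have "T_opt (val \<pi>) $ i = val \<pi> $ i"
      using T_opt_val_ge[OF \<pi>, of i] by (simp add: switchable_def max_advantage_def)
    also have "\<dots> = T_pol \<pi> (val \<pi>) $ i"
      by (simp add: T_pol_val \<pi>)
    also have "\<dots> = T_pol \<pi>' (val \<pi>) $ i"
      using False by (simp add: T_pol_nth \<pi>')
    finally show ?thesis by simp
  qed
  then show ?thesis by (simp add: vec_eq_iff)
qed

lemma howard_switch_contraction:
  assumes \<pi>: "\<pi> \<in> policies" and sw: "is_switch \<pi> (switchable \<pi>) \<pi>'"
    and c: "\<And>j. opt_val $ j - val \<pi> $ j \<le> c"
  shows "opt_val $ i - val \<pi>' $ i \<le> \<gamma> * c"
proof -
  have \<pi>': "\<pi>' \<in> policies" using is_switch_policies \<pi> sw by blast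
  \<comment> \<open>An optimal \<open>\<rho>\<close> links the two values:
    \<open>T_pol \<rho> (val \<pi>)\<close> is within \<open>\<gamma> * c\<close> below
    \<open>opt_val\<close>, and it is at most \<open>T_pol \<pi>' (val \<pi>)\<close>, hence at most
    \<open>val \<pi>'\<close>, because the update lowers no value.\<close>
  obtain \<rho> where "optimal \<rho>" using ex_optimal by blast
  then have \<rho>: "\<rho> \<in> policies" "val \<rho> = opt_val" by (auto simp: optimal_def)
  have mono: "val \<pi> $ j \<le> val \<pi>' $ j" for j
    using T_opt_val_ge[OF \<pi>] howard_switch_greedy[OF \<pi> sw] by (intro val_ge[OF \<pi>']) simp
  have "opt_val $ i - T_pol \<rho> (val \<pi>) $ i = T_pol \<rho> opt_val $ i - T_pol \<rho> (val \<pi>) $ i"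
    using T_pol_val[OF \<rho>(1)] \<rho>(2) by simp
  also have "\<dots> \<le> \<gamma> * c"
    unfolding T_pol_nth by (intro action_val_diff_le policiesD \<rho> c)
  finally have "opt_val $ i - T_pol \<rho> (val \<pi>) $ i \<le> \<gamma> * c" .
  moreover have "T_pol \<rho> (val \<pi>) $ i \<le> T_pol \<pi>' (val \<pi>) $ i"
    using T_opt_ge[OF \<rho>(1)] howard_switch_greedy[OF \<pi> sw] by simp
  moreover have "T_pol \<pi>' (val \<pi>) $ i \<le> T_pol \<pi>' (val \<pi>') $ i"
    unfolding T_pol_nth by (intro action_val_mono policiesD \<pi>' mono)
  ultimately show ?thesis by (simp add: T_pol_val \<pi>')
qed

text \<open>A run is constrained only before its first optimal policy, so all facts about it are
  relative to a horizon \<open>N\<close> up to which no policy is optimal.\<close>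

lemma howard_run_switch:
  assumes "howard_run \<pi>" "\<forall>l\<le>N. \<not> optimal (\<pi> l)" "k \<le> N"
  shows "is_switch (\<pi> k) (switchable (\<pi> k)) (\<pi> (Suc k))"
  using assms by (auto simp: howard_run_def)

lemma howard_run_policies:
  assumes "howard_run \<pi>" "\<forall>l\<le>N. \<not> optimal (\<pi> l)" "k \<le> N"
  shows "\<pi> k \<in> policies"
  using assms(3)
proof (induction k)
  case 0
  then show ?case using assms(1) by (simp add: howard_run_def)
next
  case (Suc k)
  then show ?case
    using howard_run_switch[OF assms(1,2), of k] is_switch_policies by (meson Suc_leD)
qed

lemma howard_run_contraction:
  assumes run: "howard_run \<pi>" "\<forall>l\<le>N. \<not> optimal (\<pi> l)"
    and "k + d \<le> N" and c: "\<And>j. opt_val $ j - val (\<pi> k) $ j \<le> c"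
  shows "opt_val $ i - val (\<pi> (k + d)) $ i \<le> \<gamma> ^ d * c"
  using assms(3)
proof (induction d arbitrary: i)
  case 0
  then show ?case using c by simp
next
  case (Suc d)
  have "opt_val $ i - val (\<pi> (Suc (k + d))) $ i \<le> \<gamma> * (\<gamma> ^ d * c)"
    using Suc howard_run_policies[OF run, of "k + d"] howard_run_switch[OF run, of "k + d"]
    by (intro howard_switch_contraction[of "\<pi> (k + d)"]) auto
  then show ?case by (simp add: mult.assoc)
qed

section \<open>Elimination and counting of suboptimal actions\<close>

lemma howard_run_eliminates:
  assumes run: "howard_run \<pi>" "\<forall>l\<le>N. \<not> optimal (\<pi> l)"
    and k: "k \<le> N" and K: "\<gamma> ^ K < 1 - \<gamma>"
  shows "\<exists>s. action_val opt_val s (\<pi> k s) < opt_val $ s \<and>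
           (\<forall>l. k + K \<le> l \<and> l \<le> N \<longrightarrow> \<pi> l s \<noteq> \<pi> k s)"
proof -
  define e where "e = (\<lambda>l i. opt_val $ i - T_pol (\<pi> l) opt_val $ i)"
  have pol: "\<pi> l \<in> policies" if "l \<le> N" for l
    using howard_run_policies[OF run that] .
  obtain s where s: "\<And>j. e k j \<le> e k s"
    using finite_arg_max[of UNIV "e k"] by auto
  have pos: "0 < e k s"
  proof (rule ccontr)
    assume "\<not> 0 < e k s"
    then have "e k j \<le> 0" for j using s[of j] by linarith
    then have "optimal (\<pi> k)"
      using pol[OF k] by (intro optimalI_residual) (auto simp: e_def)
    then show False using run(2) k by simp
  qed
  have "\<pi> l s \<noteq> \<pi> k s" if l: "k + K \<le> l" "l \<le> N" for l
  proof
    assume eq: "\<pi> l s = \<pi> k s"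
    define d where "d = l - k"
    have d: "l = k + d" "K \<le> d" using l by (auto simp: d_def)
    have "opt_val $ j - val (\<pi> k) $ j \<le> e k s / (1 - \<gamma>)" for j
      using loss_le_residual[OF pol[OF k]] s by (simp add: e_def)
    then have "opt_val $ s - val (\<pi> l) $ s \<le> \<gamma> ^ d * (e k s / (1 - \<gamma>))"
      using howard_run_contraction[OF run, of k d] l(2) d(1) by blast
    moreover have "e l s \<le> opt_val $ s - val (\<pi> l) $ s"
      using residual_le_loss[OF pol[OF l(2)]] by (simp add: e_def)
    \<comment> \<open>Reusing the action reproduces the residual in \<open>s\<close>, whereas the
      contracted loss bounding it has dropped strictly below \<open>e k s\<close>.\<close>
    moreover have "e l s = e k s"
      using eq by (simp add: e_def T_pol_nth)
    moreover have "\<gamma> ^ d * (e k s / (1 - \<gamma>)) < (1 - \<gamma>) * (e k s / (1 - \<gamma>))"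
    proof (rule mult_strict_right_mono)
      have "\<gamma> ^ d \<le> \<gamma> ^ K"
        using d(2) discount_pos discount_less_1 by (intro power_decreasing) auto
      then show "\<gamma> ^ d < 1 - \<gamma>" using K by simp
    qed (use pos discount_less_1 in simp)
    ultimately show False using discount_less_1 by simp
  qed
  with pos show ?thesis by (auto simp: e_def T_pol_nth)
qed

text \<open>A greedy policy for \<open>opt_val\<close> selects one action per state that is not
  suboptimal, and disjointness of the \<open>Adm i\<close> makes these actions distinct.\<close>

lemma card_suboptimal_actions:
  "card {a. \<exists>i. a \<in> Adm i \<and> action_val opt_val i a < opt_val $ i} + CARD('x) \<le> CARD('a)"
    (is "card ?B + _ \<le> _")
proof -
  obtain g where g: "g \<in> policies" "T_pol g opt_val = opt_val"
    using ex_greedy[of opt_val] by (auto simp: greedy_def T_opt_opt_val)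
  have Adm_eq: "i = j" if "g i \<in> Adm j" for i j
    using Adm_disjoint policiesD[OF g(1), of i] that by (auto simp: disjoint_family_on_def)
  then have "inj g"
    using policiesD[OF g(1)] by (metis injI)
  have "?B \<inter> range g = {}"
  proof -
    have "action_val opt_val i (g i) = opt_val $ i" for i
      using g(2) by (metis T_pol_nth)
    then show ?thesis using Adm_eq by fastforce
  qed
  then have "card ?B + card (range g) = card (?B \<union> range g)"
    by (intro card_Un_disjoint[symmetric]) auto
  also have "\<dots> \<le> CARD('a)" by (intro card_mono) auto
  finally show ?thesis using card_image[OF \<open>inj g\<close>] by simp
qed

text \<open>Otherwise the \<open>M + 1\<close> checkpoints \<open>0, K, ..., M * K\<close> would
  yield distinct suboptimal actions, but there are at most \<open>M\<close>.\<close>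

lemma howard_run_terminates:
  assumes run: "howard_run \<pi>" and K: "\<gamma> ^ K < 1 - \<gamma>"
  shows "\<exists>k \<le> (CARD('a) - CARD('x)) * K. optimal (\<pi> k)"
proof (rule ccontr)
  define M where "M = CARD('a) - CARD('x)"
  define N where "N = M * K"
  define B where "B = {a. \<exists>i. a \<in> Adm i \<and> action_val opt_val i a < opt_val $ i}"
  assume "\<not> ?thesis"
  then have nonopt: "\<forall>l\<le>N. \<not> optimal (\<pi> l)" by (auto simp: N_def M_def)
  have le_N: "t * K \<le> N" if "t \<le> M" for t using that by (simp add: N_def)
  have "\<forall>t. \<exists>s. t \<le> M \<longrightarrow> action_val opt_val s (\<pi> (t * K) s) < opt_val $ s \<and>
      (\<forall>l. t * K + K \<le> l \<and> l \<le> N \<longrightarrow> \<pi> l s \<noteq> \<pi> (t * K) s)"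
    using howard_run_eliminates[OF run nonopt _ K] le_N by meson
  then obtain s where sub: "\<And>t. t \<le> M \<Longrightarrow> action_val opt_val (s t) (\<pi> (t * K) (s t)) < opt_val $ s t"
    and elim: "\<And>t l. t \<le> M \<Longrightarrow> t * K + K \<le> l \<Longrightarrow> l \<le> N \<Longrightarrow> \<pi> l (s t) \<noteq> \<pi> (t * K) (s t)"
    by metis
  define b where "b = (\<lambda>t. \<pi> (t * K) (s t))"
  have adm: "b t \<in> Adm (s t)" if "t \<le> M" for t
    using howard_run_policies[OF run nonopt le_N[OF that]] by (simp add: b_def policiesD)
  have neq: "b t \<noteq> b u" if "t < u" "u \<le> M" for t u
  proof
    assume eq: "b t = b u"
    \<comment> \<open>An action is admissible in one state only, so a repeated action would be a
      reuse in the same state, at least \<open>K\<close> iterations later.\<close>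
    then have "s t = s u"
      using adm[of t] adm[of u] that Adm_disjoint by (auto simp: disjoint_family_on_def)
    moreover have "t * K + K \<le> u * K"
      using that(1) mult_le_mono1[of "Suc t" u K] by simp
    ultimately show False
      using eq elim[of t "u * K"] that le_N[of u] by (simp add: b_def)
  qed
  have "inj_on b {..M}"
    by (rule linorder_inj_onI) (use neq in auto)
  then have "Suc M = card (b ` {..M})" by (simp add: card_image)
  also have "\<dots> \<le> card B"
    using adm sub by (intro card_mono) (auto simp: B_def b_def)
  also have "\<dots> \<le> M"
    using card_suboptimal_actions by (simp add: B_def M_def)
  finally show False by simp
qed

end

section \<open>The explicit iteration bound and its asymptotics\<close>

lemma power_less_complement:
  fixes g :: real
  assumes "0 < g" "g < 1" and K: "1 / (1 - g) * ln (1 / (1 - g)) \<le> real K"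
  shows "g ^ K < 1 - g"
proof -
  have "0 < ln (1 / (1 - g))"
    using assms by simp
  then have "0 < 1 / (1 - g) * ln (1 / (1 - g))"
    using assms(2) by simp
  \<comment> \<open>Positivity of \<open>K\<close> keeps \<open>ln g < g - 1\<close> strict after
    multiplication.\<close>
  then have "0 < real K"
    using K by linarith
  have "ln g < g - 1"
    using assms ln_le_minus_one[of g] ln_eq_minus_one[of g] by fastforce
  then have "real K * ln g < - (real K * (1 - g))"
    using \<open>0 < real K\<close> mult_strict_left_mono[of "ln g" "g - 1" "real K"] by (simp add: algebra_simps)
  also have "\<dots> \<le> - ln (1 / (1 - g))"
    using K assms(2) by (simp add: field_simps)
  also have "\<dots> = ln (1 - g)"
    using assms(2) by (simp add: ln_div)
  finally have "ln (g ^ K) < ln (1 - g)"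
    using assms(1) by (simp add: ln_realpow)
  then show ?thesis
    using assms by simp
qed

text \<open>The bound \<open>\<gamma>\<^sub>0 \<le> g\<close> keeps the argument of the ceiling away from \<open>0\<close>.\<close>
lemma howard_bound_bigo:
  fixes \<gamma>\<^sub>0 :: real
  assumes "0 < \<gamma>\<^sub>0" "\<gamma>\<^sub>0 < 1"
  shows "(\<lambda>(n :: nat, m :: nat, g :: real).
            (real m - real n) * of_int \<lceil>1 / (1 - g) * ln (1 / (1 - g))\<rceil>)
         \<in> O[principal {(n, m, g). 1 \<le> n \<and> n \<le> m \<and> \<gamma>\<^sub>0 \<le> g \<and> g < 1}](
            \<lambda>(n, m, g). real m / (1 - g) * ln (1 / (1 - g)))"
proof -
  define x where "x = (\<lambda>g :: real. 1 / (1 - g) * ln (1 / (1 - g)))"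
  define c where "c = ln (1 / (1 - \<gamma>\<^sub>0))"
  have "0 < c" using assms by (simp add: c_def)
  have "\<bar>(real m - real n) * of_int \<lceil>x g\<rceil>\<bar> \<le> (1 + 1 / c) * \<bar>real m / (1 - g) * ln (1 / (1 - g))\<bar>"
    if "n \<le> m" "\<gamma>\<^sub>0 \<le> g" "g < 1" for n m :: nat and g
  proof -
    have "c \<le> ln (1 / (1 - g))"
      unfolding c_def using that assms by (subst ln_le_cancel_iff) (auto simp: frac_le)
    moreover have "1 * ln (1 / (1 - g)) \<le> x g"
      unfolding x_def using that assms by (intro mult_right_mono) auto
    ultimately have "c \<le> x g" by simp
    \<comment> \<open>This absorbs the \<open>+ 1\<close> from rounding up into a multiple of
      \<open>x g\<close>.\<close>
    then have "1 \<le> x g / c" using \<open>0 < c\<close> by simp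
    have "0 \<le> x g" using \<open>c \<le> x g\<close> \<open>0 < c\<close> by simp
    have "\<bar>(real m - real n) * of_int \<lceil>x g\<rceil>\<bar> = (real m - real n) * of_int \<lceil>x g\<rceil>"
      using that \<open>0 \<le> x g\<close> by (intro abs_of_nonneg mult_nonneg_nonneg) auto
    also have "\<dots> \<le> real m * (x g + 1)"
      using that \<open>0 \<le> x g\<close> by (intro mult_mono) (auto intro: of_int_ceiling_le_add_one)
    also have "\<dots> \<le> real m * (x g + x g / c)"
      using \<open>1 \<le> x g / c\<close> by (intro mult_left_mono) auto
    also have "\<dots> = (1 + 1 / c) * (real m * x g)"
      by (simp add: algebra_simps)
    also have "real m * x g = \<bar>real m * x g\<bar>"
      using \<open>0 \<le> x g\<close> by simp
    finally show ?thesis by (simp add: x_def)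
  qed
  then show ?thesis
    by (intro bigoI[where c = "1 + 1 / c"]) (auto simp: eventually_principal x_def)
qed

theorem theorem3:
  fixes Adm :: "'x::finite \<Rightarrow> 'a::finite set"
    and p :: "'x \<Rightarrow> 'x \<Rightarrow> 'a \<Rightarrow> real"
    and r :: "'x \<Rightarrow> 'a \<Rightarrow> 'x \<Rightarrow> real"
    and \<gamma> :: real
  assumes "finite_mdp Adm p \<gamma>"
  shows "(\<forall>\<pi>. finite_mdp.howard_run Adm p r \<gamma> \<pi> \<longrightarrow>
            (\<exists>k. finite_mdp.optimal Adm p r \<gamma> (\<pi> k) \<and>
                 int k \<le> (int CARD('a) - int CARD('x)) * \<lceil>1 / (1 - \<gamma>) * ln (1 / (1 - \<gamma>))\<rceil>))
       \<and> (\<forall>\<gamma>\<^sub>0. 0 < \<gamma>\<^sub>0 \<and> \<gamma>\<^sub>0 < 1 \<longrightarrow>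
            (\<lambda>(n :: nat, m :: nat, g :: real).
                (real m - real n) * of_int \<lceil>1 / (1 - g) * ln (1 / (1 - g))\<rceil>)
            \<in> O[principal {(n, m, g). 1 \<le> n \<and> n \<le> m \<and> \<gamma>\<^sub>0 \<le> g \<and> g < 1}](
               \<lambda>(n, m, g). real m / (1 - g) * ln (1 / (1 - g))))"
proof (intro conjI allI impI)
  interpret finite_mdp Adm p r \<gamma> by fact
  define x where "x = 1 / (1 - \<gamma>) * ln (1 / (1 - \<gamma>))"
  define K where "K = nat \<lceil>x\<rceil>"
  have "0 \<le> x"
    using discount_pos discount_less_1 by (simp add: x_def)
  then have K: "int K = \<lceil>x\<rceil>"
    by (simp add: K_def)
  have "x \<le> real K"
    by (simp add: K_def real_nat_ceiling_ge)
  then have "\<gamma> ^ K < 1 - \<gamma>"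
    using power_less_complement discount_pos discount_less_1 by (simp add: x_def)
  moreover fix \<pi> assume "howard_run \<pi>"
  ultimately obtain k where k: "k \<le> (CARD('a) - CARD('x)) * K" "optimal (\<pi> k)"
    using howard_run_terminates by blast
  \<comment> \<open>Makes the truncated subtraction on naturals agree with the integer one.\<close>
  have "CARD('x) \<le> CARD('a)"
    using card_suboptimal_actions by simp
  then have "int k \<le> (int CARD('a) - int CARD('x)) * \<lceil>x\<rceil>"
    using k(1) by (simp flip: K of_nat_diff of_nat_mult)
  with k(2) show "\<exists>k. optimal (\<pi> k) \<and>
      int k \<le> (int CARD('a) - int CARD('x)) * \<lceil>1 / (1 - \<gamma>) * ln (1 / (1 - \<gamma>))\<rceil>"
    unfolding x_def by blast
qed (use howard_bound_bigo in blast)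

end
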